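(* Any rigid-body motion of $\mathbb R^3$ is induced by two pairs of reflections in $\mathbb R^{3,3}$ such that each pair induces an affine transformation. Specifically, consider a rotation $R$ about the origin in a plane spanned by two orthonormal directions $v_1,v_2\in\mathbb R^3$ with angle $\theta\neq 0$ (from $v_1$ toward $v_2$), followed by a translation along a vector $t\in\mathbb R^3$, i.e. the rigid-body motion $p\mapsto Rp+t$. Put $n=v_1\times v_2$, $\gamma=\cos(\theta/2)$, $\sigma=\sin(\theta/2)$. Let $d=t\cdot n$ be the screw driving distance, and let $$\mathbf c=\frac{R_{\frac{\pi-\theta}{2}}\bigl(t-(t\cdot n)n\bigr)}{2\sin\frac{\theta}{2}}$$ be the original center of the screw motion, where $R_\alpha$ is the rotation of angle $\alpha$ about the unit direction $n$ at the origin. Then the motion is induced by the four reflections with respect to the following vectors of $\mathbb R^{3,3}$, applied sequentially from right to left: $$\begin{pmatrix} \gamma v_1+\sigma v_2 \\ -(\gamma v_1+\sigma v_2)+m_1 \end{pmatrix},\quad\begin{pmatrix} \gamma v_1+\sigma v_2 \\ \gamma v_1+\sigma v_2+m_1 \end{pmatrix},\quad\begin{pmatrix} v_1 \\ -v_1+m_2 \end{pmatrix},\quad\begin{pmatrix} v_1 \\ v_1+m_2 \end{pmatrix},$$ where we can choose either $$m_1=(\gamma v_1+\sigma v_2)\times\Bigl(\mathbf c+\frac d2 n\Bigr),\qquad m_2=v_1\times \mathbf c,$$ or $$m_1=(\gamma v_1+\sigma v_2)\times \mathbf c,\qquad m_2=v_1\times\Bigl(\mathbf c-\frac d2 n\B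igr).$$
   Context: Let $e_0,e_1,e_2,e_3$ be the standard orthonormal basis of $\mathbb R^4$ and identify $\mathbb R^3=\mathrm{span}(e_1,e_2,e_3)$. $\mathbb R^{3,3}=\Lambda^2(\mathbb R^4)$ has basis $E_i=e_0\wedge e_i$ ($i=1,2,3$), $E_1'=e_2\wedge e_3$, $E_2'=e_3\wedge e_1$, $E_3'=e_1\wedge e_2$ and symmetric bilinear form $E_i\cdot E_j'=\delta_{ij}$, $E_i\cdot E_j=E_i'\cdot E_j'=0$. For $x,y\in\mathbb R^3$, $\begin{pmatrix} x \\ y \end{pmatrix}$ denotes the vector $\sum_i x_iE_i+\sum_i y_iE_i'$ of $\mathbb R^{3,3}$; it is invertible iff $x\cdot y\ne0$. The reflection with respect to an invertible $U\in\mathbb R^{3,3}$ is $V\mapsto V-2\frac{V\cdot U}{U\cdot U}U$. A rigid-body motion is a map $p\mapsto Rp+t$ of $\mathbb R^3$ with $R\in SO(3)$, $t\in\mathbb R^3$; when $R$ is not the identity it is a screw motion, i.e. a rotation about an affine line (the screw axis) followed by a translation along that axis by the screw driving distance, and its original center is the foot of the perpendicular from the origin to the screw axis. A linear isometry $g$ of $\mathbb R^{3,3}$ induces the affine map $p\mapsto Lp+t$ of $\mathbb R^3$ (matrix $A=\begin{pmatrix} 1 & 0 \\ t & L \end{pmatrix}$ on $\mathbb R^4$ in the basis $e_0,\dots,e_3$) if for every nonzero $X\in\mathbb R^4$, $g$ maps the null 3-space $\{X\wedge Y:Y\in\mathbb R^4\}$ (the lines through the point $X$) to $\{AX\wedge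 Y:Y\in\mathbb R^4\}$.
   Formalization: With the given basis the printed m1, m2 induce p ↦ Rp − t; all cross products in m1, m2 are reversed, e.g. m1 = (c + (d/2)n) × (γv1+σv2), m2 = c × v1, and likewise in the second choice; θ ≠ 0 is read as θ not a multiple of 2π, since otherwise c is undefined. *)

theory Defs
  imports "HOL-Analysis.Analysis"
begin

unbundle cross3_syntax

text \<open>
  \<open>R4\<close> is \<open>\<real> e\<^sub>0 \<oplus> span(e\<^sub>1, e\<^sub>2, e\<^sub>3)\<close>, so \<open>(a, x)\<close> stands for \<open>a e\<^sub>0 + x\<close>.
  \<open>R33\<close> is the exterior square of \<open>R4\<close> in the coordinates of the basis
  \<open>e\<^sub>0\<and>e\<^sub>1, e\<^sub>0\<and>e\<^sub>2, e\<^sub>0\<and>e\<^sub>3, e\<^sub>2\<and>e\<^sub>3, e\<^sub>3\<and>e\<^sub>1, e\<^sub>1\<and>e\<^sub>2\<close>; the pair \<open>(x, y)\<close> is the column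
  vector with upper block \<open>x\<close> and lower block \<open>y\<close>.
\<close>

type_synonym R3 = "real ^ 3"
type_synonym R4 = "real \<times> (real ^ 3)"
type_synonym R33 = "(real ^ 3) \<times> (real ^ 3)"

text \<open>
  \<open>(a e\<^sub>0 + x) \<and> (b e\<^sub>0 + y) = e\<^sub>0 \<and> (a y - b x) + x \<and> y\<close>, and the coordinates of \<open>x \<and> y\<close> with
  respect to \<open>e\<^sub>2\<and>e\<^sub>3, e\<^sub>3\<and>e\<^sub>1, e\<^sub>1\<and>e\<^sub>2\<close> are those of the cross product.
\<close>

definition wedge :: "R4 \<Rightarrow> R4 \<Rightarrow> R33" where
  "wedge X Y = (fst X *\<^sub>R snd Y - fst Y *\<^sub>R snd X, snd X \<times> snd Y)"

lemma wedge_self: "wedge X X = 0"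
  by (simp add: wedge_def zero_prod_def)

lemma bilinear_wedge: "bilinear wedge"
  unfolding bilinear_def
  by (intro conjI allI linearI)
     (simp_all add: wedge_def cross_add_left cross_add_right cross_mult_left cross_mult_right
        algebra_simps)

lemma wedge_basis:
  "wedge (1, 0) (0, axis i 1) = (axis i 1, 0)"
  "wedge (0, axis 2 1) (0, axis 3 1) = (0, axis 1 1)"
  "wedge (0, axis 3 1) (0, axis 1 1) = (0, axis 2 1)"
  "wedge (0, axis 1 1) (0, axis 2 1) = (0, axis 3 1)"
  by (simp_all add: wedge_def cross_basis)

definition pairing :: "R33 \<Rightarrow> R33 \<Rightarrow> real" where
  "pairing V U = fst V \<bullet> snd U + snd V \<bullet> fst U"

definition invertible_R33 :: "R33 \<Rightarrow> bool" where
  "invertible_R33 U \<longleftrightarrow> fst U \<bullet> snd U \<noteq> 0"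

lemma pairing_self: "pairing U U = 2 * (fst U \<bullet> snd U)"
  by (simp add: pairing_def inner_commute)

definition reflection :: "R33 \<Rightarrow> R33 \<Rightarrow> R33" where
  "reflection U V = V - (2 * (pairing V U / pairing U U)) *\<^sub>R U"

definition linear_isometry_R33 :: "(R33 \<Rightarrow> R33) \<Rightarrow> bool" where
  "linear_isometry_R33 g \<longleftrightarrow> linear g \<and> (\<forall>V W. pairing (g V) (g W) = pairing V W)"

definition lines_through :: "R4 \<Rightarrow> R33 set" where
  "lines_through X = range (wedge X)"

text \<open>The argument of \<open>lines_through\<close> on the right is the block matrix \<open>(1 0; t L)\<close> applied to \<open>X\<close>.\<close>

definition induces :: "(R33 \<Rightarrow> R33) \<Rightarrow> (R3 \<Rightarrow> R3) \<Rightarrow> bool" where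
  "induces g f \<longleftrightarrow> linear_isometry_R33 g \<and>
     (\<exists>(L :: real ^ 3 ^ 3) t. f = (\<lambda>p. L *v p + t) \<and>
        (\<forall>X. X \<noteq> 0 \<longrightarrow>
           g ` lines_through X = lines_through (fst X, fst X *\<^sub>R t + L *v snd X)))"

definition rigid_body_motion :: "(R3 \<Rightarrow> R3) \<Rightarrow> bool" where
  "rigid_body_motion f \<longleftrightarrow>
     (\<exists>(R :: real ^ 3 ^ 3) t. rotation_matrix R \<and> f = (\<lambda>p. R *v p + t))"

text \<open>
  For orthonormal \<open>v1, v2\<close>: the rotation by \<open>\<theta>\<close> from \<open>v1\<close> toward \<open>v2\<close> in the plane they span,
  fixing the orthogonal complement of that plane.
\<close>

definition plane_rotation :: "R3 \<Rightarrow> R3 \<Rightarrow> real \<Rightarrow> R3 \<Rightarrow> R3" where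
  "plane_rotation v1 v2 \<theta> p =
     (p - (p \<bullet> v1) *\<^sub>R v1 - (p \<bullet> v2) *\<^sub>R v2)
     + (p \<bullet> v1) *\<^sub>R (cos \<theta> *\<^sub>R v1 + sin \<theta> *\<^sub>R v2)
     + (p \<bullet> v2) *\<^sub>R (- sin \<theta> *\<^sub>R v1 + cos \<theta> *\<^sub>R v2)"

text \<open>Rodrigues' formula, for a unit vector \<open>n\<close>.\<close>

definition axis_rotation :: "R3 \<Rightarrow> real \<Rightarrow> R3 \<Rightarrow> R3" where
  "axis_rotation n \<alpha> p =
     cos \<alpha> *\<^sub>R p + sin \<alpha> *\<^sub>R (n \<times> p) + ((1 - cos \<alpha>) * (n \<bullet> p)) *\<^sub>R n"

definition line_along :: "R3 \<Rightarrow> R3 \<Rightarrow> R3 set" where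
  "line_along q u = range (\<lambda>s. q + s *\<^sub>R u)"

text \<open>Rotation by \<open>\<alpha>\<close> about the oriented line through \<open>q\<close> with unit direction \<open>u\<close>,
  then translation by \<open>d u\<close>.\<close>

definition screw_motion :: "R3 \<Rightarrow> R3 \<Rightarrow> real \<Rightarrow> real \<Rightarrow> R3 \<Rightarrow> R3" where
  "screw_motion q u \<alpha> d p = (q + axis_rotation u \<alpha> (p - q)) + d *\<^sub>R u"

definition foot_of_perpendicular :: "R3 \<Rightarrow> R3 set \<Rightarrow> R3 \<Rightarrow> bool" where
  "foot_of_perpendicular x l q \<longleftrightarrow> q \<in> l \<and> (\<forall>p\<in>l. orthogonal (p - q) (x - q))"

text \<open>
  Orientation pitfall: by the definition of \<open>wedge\<close>, the line through the point \<open>p\<close> with direction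
  \<open>v\<close> is \<open>(v, p \<times> v)\<close>, so a moment vector is position times direction, in this order.
  For \<open>v \<noteq> 0\<close>, the reflections in \<open>(v, - v + p \<times> v)\<close> and \<open>(v, v + p \<times> v)\<close> compose to a map inducing
  the half-turn about that line; with \<open>v \<times> p\<close> instead, the half-turn is about the line through \<open>- p\<close>.
\<close>

lemma line_point_direction: "wedge (1, p) (0, v) = (v, p \<times> v)"
  by (simp add: wedge_def)

end

theory Submission
  imports Defs
begin

text \<open>
  The reflections in \<open>(w, - w + q \<times> w)\<close> and \<open>(w, w + q \<times> w)\<close>, for a unit vector \<open>w\<close>, compose to the
  negative of the action on lines of the half-turn about the line through \<open>q\<close> in direction \<open>w\<close>.
  Four reflections thus induce a product of two half-turns. The product of half-turns about \<open>v\<^sub>1\<close> and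
  \<open>w\<close>, the direction at angle \<open>\<theta>/2\<close> from \<open>v\<^sub>1\<close>, is the rotation by \<open>\<theta>\<close>, and displacing one of the two
  axes by \<open>d/2\<close> along the common normal adds the translation by \<open>d\<close>.
  Every rotation has an axis, since \<open>det (R - 1) = 0\<close>; a pure translation is a product of half-turns
  about parallel lines.
\<close>

section \<open>Proper linear isometries of 3-space and rotation matrices\<close>

lemmas cross_linear_simps =
  cross_add_left cross_add_right cross_mult_left cross_mult_right
  Cross3.left_diff_distrib Cross3.right_diff_distrib

lemmas inner_linear_simps =
  inner_add_left inner_add_right inner_diff_left inner_diff_right

text \<open>Orientation is encoded by compatibility with the cross product instead of a determinant:
  the exterior square uses it in this form, and it passes to compositions at once.\<close>

definition proper_isometry :: "(R3 \<Rightarrow> R3) \<Rightarrow> bool" where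
  "proper_isometry L \<longleftrightarrow>
     orthogonal_transformation L \<and> (\<forall>x y. L x \<times> L y = L (x \<times> y))"

text \<open>The exterior square of the block matrix \<open>(1 0; t L)\<close>, simplified by \<open>L x \<times> L y = L (x \<times> y)\<close>.\<close>

definition line_map :: "(R3 \<Rightarrow> R3) \<Rightarrow> R3 \<Rightarrow> R33 \<Rightarrow> R33" where
  "line_map L t V = (L (fst V), t \<times> L (fst V) + L (snd V))"

text \<open>For unit \<open>w\<close> this keeps the component along \<open>w\<close> and negates
  the orthogonal one.\<close>

definition half_turn :: "R3 \<Rightarrow> R3 \<Rightarrow> R3" where
  "half_turn w x = (2 * (x \<bullet> w)) *\<^sub>R w - x"

lemma proper_isometry_linear: "proper_isometry L \<Longrightarrow> linear L"
  by (simp add: proper_isometry_def orthogonal_transformation_def)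

lemma proper_isometry_inner: "proper_isometry L \<Longrightarrow> L x \<bullet> L y = x \<bullet> y"
  by (simp add: proper_isometry_def orthogonal_transformation_def)

lemma proper_isometry_cross: "proper_isometry L \<Longrightarrow> L x \<times> L y = L (x \<times> y)"
  by (simp add: proper_isometry_def)

lemma proper_isometry_compose:
  "proper_isometry L \<Longrightarrow> proper_isometry M \<Longrightarrow> proper_isometry (L \<circ> M)"
  by (simp add: proper_isometry_def orthogonal_transformation_compose)

lemma proper_isometry_rotation_matrix:
  assumes "rotation_matrix A"
  shows "proper_isometry (\<lambda>x. A *v x)"
  using assms cross_rotation_matrix[OF assms]
  by (simp add: proper_isometry_def rotation_matrix_def orthogonal_transformation_matrix)

text \<open>An orthogonal map respects cross products up to the factor
  \<open>det (matrix L)\<close>. Here no factor appears, and comparing both formulas on one basis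
  vector gives determinant 1.\<close>

lemma rotation_matrix_proper_isometry:
  assumes L: "proper_isometry L"
  shows "rotation_matrix (matrix L)"
proof -
  have o: "orthogonal_transformation L"
    using L by (simp add: proper_isometry_def)
  let ?e1 = "axis 1 1 :: R3" and ?e2 = "axis 2 1 :: R3" and ?e3 = "axis 3 1 :: R3"
  have "L ?e3 = det (matrix L) *\<^sub>R L ?e3"
    using cross_orthogonal_transformation[OF o, of ?e1 ?e2] proper_isometry_cross[OF L, of ?e1 ?e2]
    by (simp add: cross_basis)
  moreover have "L ?e3 \<noteq> 0"
    using orthogonal_transformation_norm[OF o, of ?e3] by auto
  ultimately have "det (matrix L) = 1"
    by (metis scaleR_cancel_right scaleR_one)
  then show ?thesis
    using o by (simp add: rotation_matrix_def orthogonal_transformation_matrix)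
qed

lemma matrix_proper_isometry: "proper_isometry L \<Longrightarrow> matrix L *v x = L x"
  using matrix_vector_mul(2)[OF proper_isometry_linear] by metis

lemma rigid_body_motion_proper_isometry:
  assumes "proper_isometry L"
  shows "rigid_body_motion (\<lambda>p. L p + t)"
  unfolding rigid_body_motion_def
  using rotation_matrix_proper_isometry[OF assms] matrix_proper_isometry[OF assms]
  by (intro exI[of _ "matrix L"] exI[of _ t]) auto

section \<open>The action of Euclidean motions on line coordinates\<close>

lemma line_map_wedge:
  assumes L: "proper_isometry L"
  shows "line_map L t (wedge X Y) =
    wedge (fst X, fst X *\<^sub>R t + L (snd X)) (fst Y, fst Y *\<^sub>R t + L (snd Y))"
  \<comment> \<open>For \<open>X = (a, x)\<close> and \<open>Y = (b, y)\<close>, the mixed terms of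
    the lower block are \<open>a\<close> times \<open>t \<times> L y\<close> and \<open>b\<close>
    times \<open>L x \<times> t\<close>; skewness combines them into
    \<open>t \<times> L (a y - b x)\<close>.\<close>
  using proper_isometry_linear[OF L] proper_isometry_cross[OF L] cross_skew[of t "L (snd X)"]
  by (simp add: line_map_def wedge_def linear_diff linear_cmul cross_linear_simps algebra_simps)

lemma lines_through_line_map:
  assumes L: "proper_isometry L"
  shows "line_map L t ` lines_through X = lines_through (fst X, fst X *\<^sub>R t + L (snd X))"
proof -
  have "surj L"
    using L by (simp add: proper_isometry_def orthogonal_transformation_surj)
  then have "\<exists>Y. Z = (fst Y, fst Y *\<^sub>R t + L (snd Y))" for Z :: R4
    \<comment> \<open>The witness is the image of \<open>Z\<close> under the inverse of the block
      matrix, so the second point still ranges over all of \<open>R4\<close>.\<close>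
    by (intro exI[of _ "(fst Z, inv L (snd Z - fst Z *\<^sub>R t))"]) (simp add: surj_f_inv_f)
  then have "range (\<lambda>Y :: R4. (fst Y, fst Y *\<^sub>R t + L (snd Y))) = UNIV"
    by blast
  then show ?thesis
    unfolding lines_through_def image_image line_map_wedge[OF L]
    by (metis image_image)
qed

text \<open>The sign left by a pair of reflections is invisible to \<open>induces\<close>, because
  the null 3-space of a point is closed under negation.\<close>

lemma uminus_lines_through: "uminus ` lines_through X = lines_through X"
proof -
  have m: "- wedge X Y = wedge X (- Y)" for Y
    by (simp add: wedge_def)
  have "range (uminus :: R4 \<Rightarrow> R4) = UNIV"
    by (rule surjI[of _ uminus]) simp
  then show ?thesis
    unfolding lines_through_def image_image m by (metis image_image)
qed

lemma linear_isometry_line_map: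
  assumes L: "proper_isometry L"
  shows "linear_isometry_R33 (line_map L t)"
proof -
  have "linear (line_map L t)"
    using proper_isometry_linear[OF L]
    by (intro linearI)
       (simp_all add: line_map_def linear_add linear_cmul cross_linear_simps algebra_simps)
  moreover have "pairing (line_map L t V) (line_map L t W) = pairing V W" for V W
    \<comment> \<open>The two terms containing \<open>t\<close> are triple products of the same
      three vectors with opposite orientation, so they cancel.\<close>
    using cross_triple[of t "L (fst V)" "L (fst W)"] cross_skew[of "L (fst V)" "L (fst W)"]
      cross_triple[of t "L (fst W)" "L (fst V)"]
    by (simp add: pairing_def line_map_def inner_linear_simps proper_isometry_inner[OF L]
        inner_commute[of "L (fst V)" "t \<times> _"] inner_minus_left)
  ultimately show ?thesis
    by (simp add: linear_isometry_R33_def)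
qed

lemma linear_isometry_uminus:
  "linear_isometry_R33 g \<Longrightarrow> linear_isometry_R33 (\<lambda>V. - g V)"
  by (simp add: linear_isometry_R33_def linear_compose_neg pairing_def)

lemma induces_line_map:
  assumes L: "proper_isometry L"
  shows "induces (line_map L t) (\<lambda>p. L p + t)"
  unfolding induces_def
  using linear_isometry_line_map[OF L] lines_through_line_map[OF L]
    matrix_proper_isometry[OF L]
  by (intro conjI exI[of _ "matrix L"] exI[of _ t]) auto

lemma induces_uminus:
  assumes "induces g f"
  shows "induces (\<lambda>V. - g V) f"
proof -
  have "(\<lambda>V. - g V) ` lines_through X = uminus ` (g ` lines_through X)" for X
    by (simp add: image_image)
  then show ?thesis
    using assms unfolding induces_def
    by (metis linear_isometry_uminus uminus_lines_through)
qed

lemma line_map_compose: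
  assumes L: "proper_isometry L"
  shows "line_map L t (line_map M s V) = line_map (L \<circ> M) (t + L s) V"
  using proper_isometry_linear[OF L]
  by (simp add: line_map_def linear_add proper_isometry_cross[OF L] cross_linear_simps)

lemma line_map_uminus:
  "proper_isometry L \<Longrightarrow> line_map L t (- V) = - line_map L t V"
  by (simp add: line_map_def linear_neg proper_isometry_linear)

section \<open>Half-turns and the pairs of reflections that induce them\<close>

lemma proper_isometry_half_turn:
  assumes "norm w = 1"
  shows "proper_isometry (half_turn w)"
proof -
  have w: "w \<bullet> w = 1"
    using assms by (simp add: norm_eq_1)
  have "linear (half_turn w)"
    by (intro linearI) (simp_all add: half_turn_def inner_linear_simps algebra_simps)
  moreover have "half_turn w x \<bullet> half_turn w y = x \<bullet> y" for x y
    using w by (simp add: half_turn_def inner_linear_simps inner_commute algebra_simps)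
  moreover have "half_turn w x \<times> half_turn w y = half_turn w (x \<times> y)" for x y
  proof -
    \<comment> \<open>This double product is evaluated in two ways: from the outside it yields the
      half-turn of \<open>x \<times> y\<close>, from the inside the mixed terms of the product of
      the two half-turns.\<close>
    have "w \<times> (w \<times> (x \<times> y)) = (w \<bullet> (x \<times> y)) *\<^sub>R w - x \<times> y"
      using w by (simp add: Lagrange[of w w])
    moreover have "w \<times> (w \<times> (x \<times> y)) = (w \<bullet> y) *\<^sub>R (w \<times> x) - (w \<bullet> x) *\<^sub>R (w \<times> y)"
      by (simp add: Lagrange[of w x y] cross_linear_simps)
    moreover have "half_turn w x \<times> half_turn w y =
        2 *\<^sub>R ((w \<bullet> y) *\<^sub>R (w \<times> x) - (w \<bullet> x) *\<^sub>R (w \<times> y)) + x \<times> y"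
      by (simp add: half_turn_def cross_linear_simps cross_skew[of x w] inner_commute
          scaleR_diff_right)
    ultimately show ?thesis
      by (simp add: half_turn_def inner_commute scaleR_diff_right scaleR_2)
  qed
  ultimately show ?thesis
    by (simp add: proper_isometry_def orthogonal_transformation_def)
qed

text \<open>A reflection vector knows \<open>q\<close> only through the moment
  \<open>q \<times> w\<close>; this isolates the part of \<open>q \<times> x\<close> that depends on
  the moment. With the factor \<open>w \<bullet> w\<close> on the left it is a polynomial identity,
  checked in coordinates.\<close>

lemma cross_unit_decomposition:
  assumes w: "w \<bullet> w = 1"
  shows "q \<times> x = (x \<bullet> w) *\<^sub>R (q \<times> w) - (x \<bullet> (q \<times> w)) *\<^sub>R w + (q \<bullet> w) *\<^sub>R (w \<times> x)"
proof -
  have "(w \<bullet> w) *\<^sub>R (q \<times> x) =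
      (x \<bullet> w) *\<^sub>R (q \<times> w) - (x \<bullet> (q \<times> w)) *\<^sub>R w + (q \<bullet> w) *\<^sub>R (w \<times> x)"
    unfolding vec_eq_iff forall_3
    by (simp add: cross_components inner_vec_def sum_3 algebra_simps)
  then show ?thesis
    using w by simp
qed

lemma invertible_line_pair:
  assumes "norm w = 1"
  shows "invertible_R33 (w, - w + q \<times> w)" "invertible_R33 (w, w + q \<times> w)"
  using assms by (simp_all add: invertible_R33_def inner_linear_simps dot_cross_self norm_eq_1)

text \<open>The half-turn about the line through \<open>q\<close> fixes \<open>q\<close>, hence its
  translation part is \<open>q - half_turn w q\<close>. Both sides are computed explicitly and
  compared blockwise.\<close>

lemma reflection_pair:
  assumes "norm w = 1"
  shows "(reflection (w, - w + q \<times> w) \<circ> reflection (w, w + q \<times> w)) V =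
    - line_map (half_turn w) (q - half_turn w q) V"
proof -
  obtain x y where V: "V = (x, y)"
    by (cases V)
  have w: "w \<bullet> w = 1"
    using assms by (simp add: norm_eq_1)
  define m where "m = q \<times> w"
  have wm: "w \<bullet> m = 0" "m \<bullet> w = 0"
    by (simp_all add: m_def dot_cross_self)
  \<comment> \<open>As \<open>m\<close> is orthogonal to \<open>w\<close>, the self-pairings of the
    two vectors are -2 and 2. The upper block is already \<open>- half_turn w x\<close>.\<close>
  have "(reflection (w, - w + m) \<circ> reflection (w, w + m)) V =
      (x - (2 * (x \<bullet> w)) *\<^sub>R w,
       y - (2 * (x \<bullet> w)) *\<^sub>R m - (2 * (x \<bullet> m) + 2 * (y \<bullet> w)) *\<^sub>R w)"
    using w wm
    by (simp add: V reflection_def pairing_def inner_linear_simps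
        add_divide_distrib diff_divide_distrib algebra_simps flip: scaleR_2)
  moreover have "(q - half_turn w q) \<times> half_turn w x = (2 * (x \<bullet> w)) *\<^sub>R m + (2 * (x \<bullet> m)) *\<^sub>R w"
  proof -
    have "q \<times> x = (x \<bullet> w) *\<^sub>R m - (x \<bullet> m) *\<^sub>R w + (q \<bullet> w) *\<^sub>R (w \<times> x)"
      unfolding m_def by (rule cross_unit_decomposition[OF w])
    moreover have "q - half_turn w q = 2 *\<^sub>R (q - (q \<bullet> w) *\<^sub>R w)"
      by (simp add: half_turn_def scaleR_2 algebra_simps)
    then have "(q - half_turn w q) \<times> half_turn w x =
        2 *\<^sub>R ((2 * (x \<bullet> w)) *\<^sub>R m - q \<times> x + (q \<bullet> w) *\<^sub>R (w \<times> x))"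
      by (simp add: half_turn_def cross_linear_simps m_def scaleR_add_right scaleR_diff_right)
    \<comment> \<open>Substituting the decomposition of \<open>q \<times> x\<close> cancels the
      terms in \<open>w \<times> x\<close>, leaving only the moment \<open>m\<close>.\<close>
    ultimately have "(q - half_turn w q) \<times> half_turn w x =
        2 *\<^sub>R ((2 * (x \<bullet> w) - x \<bullet> w) *\<^sub>R m + (x \<bullet> m) *\<^sub>R w)"
      by (simp only: scaleR_diff_left) simp
    then show ?thesis
      by (simp add: scaleR_add_right)
  qed
  ultimately show ?thesis
    unfolding m_def[symmetric]
    by (simp add: V line_map_def half_turn_def[of w x] half_turn_def[of w y] algebra_simps)
qed

lemma induces_half_turn:
  assumes w: "norm w = 1"
  shows "induces (reflection (w, - w + q \<times> w) \<circ> reflection (w, w + q \<times> w))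
    (\<lambda>p. half_turn w p + (q - half_turn w q))"
proof -
  have "reflection (w, - w + q \<times> w) \<circ> reflection (w, w + q \<times> w) =
      (\<lambda>V. - line_map (half_turn w) (q - half_turn w q) V)"
    using reflection_pair[OF w] by blast
  then show ?thesis
    by (simp only: induces_uminus induces_line_map proper_isometry_half_turn[OF w])
qed

text \<open>The minus signs of the two pairs cancel, and line maps compose like the motions. The
  hypothesis on \<open>f\<close> spells out the product of the half-turns about the lines through
  \<open>r\<close> and then \<open>q\<close>.\<close>

lemma induces_two_half_turns:
  assumes w: "norm w = 1" and v: "norm v = 1"
    and f: "\<And>p. f p = half_turn w (half_turn v p) +
      (q - half_turn w q + half_turn w (r - half_turn v r))"
  shows "induces (reflection (w, - w + q \<times> w) \<circ> reflection (w, w + q \<times> w) \<circ>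
    reflection (v, - v + r \<times> v) \<circ> reflection (v, v + r \<times> v)) f"
proof -
  note W = proper_isometry_half_turn[OF w] and U = proper_isometry_half_turn[OF v]
  have "reflection (w, - w + q \<times> w) \<circ> reflection (w, w + q \<times> w) \<circ>
      reflection (v, - v + r \<times> v) \<circ> reflection (v, v + r \<times> v) =
      line_map (half_turn w \<circ> half_turn v)
        (q - half_turn w q + half_turn w (r - half_turn v r))"
  proof
    fix V
    show "(reflection (w, - w + q \<times> w) \<circ> reflection (w, w + q \<times> w) \<circ>
      reflection (v, - v + r \<times> v) \<circ> reflection (v, v + r \<times> v)) V =
      line_map (half_turn w \<circ> half_turn v)
        (q - half_turn w q + half_turn w (r - half_turn v r)) V"
      using reflection_pair[OF w, of q] reflection_pair[OF v, of r V]
      by (simp add: line_map_uminus[OF W] line_map_compose[OF W])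
  qed
  moreover have "f = (\<lambda>p. (half_turn w \<circ> half_turn v) p +
      (q - half_turn w q + half_turn w (r - half_turn v r)))"
    using f by auto
  ultimately show ?thesis
    using induces_line_map[OF proper_isometry_compose[OF W U]] by metis
qed

section \<open>Rotations in a plane as products of half-turns, and Rodrigues' formula\<close>

lemma plane_rotation_half_turns:
  assumes "norm v1 = 1" "orthogonal v1 v2"
  shows "plane_rotation v1 v2 \<theta> p =
    half_turn (cos (\<theta>/2) *\<^sub>R v1 + sin (\<theta>/2) *\<^sub>R v2) (half_turn v1 p)"
proof -
  have o: "v1 \<bullet> v1 = 1" "v1 \<bullet> v2 = 0" "v2 \<bullet> v1 = 0"
    using assms by (auto simp: norm_eq_1 orthogonal_def inner_commute)
  \<comment> \<open>Both forms of the cosine formula are kept: the first matches the coefficient of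
    \<open>v1\<close>, the second that of \<open>v2\<close>.\<close>
  have C: "cos \<theta> = 2 * (cos (\<theta>/2))\<^sup>2 - 1" and S: "sin \<theta> = 2 * sin (\<theta>/2) * cos (\<theta>/2)"
    and C': "cos \<theta> = 1 - 2 * (sin (\<theta>/2))\<^sup>2"
    using cos_double_cos[of "\<theta>/2"] sin_double[of "\<theta>/2"] cos_double_sin[of "\<theta>/2"] by simp_all
  define a b where "a = p \<bullet> v1" and "b = p \<bullet> v2"
  define g s where "g = cos (\<theta>/2)" and "s = sin (\<theta>/2)"
  have "half_turn (g *\<^sub>R v1 + s *\<^sub>R v2) (half_turn v1 p) =
      p + (2 * (a * g - b * s) * g - 2 * a) *\<^sub>R v1 + (2 * (a * g - b * s) * s) *\<^sub>R v2"
    using o by (simp add: half_turn_def inner_linear_simps a_def b_def algebra_simps)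
  moreover have "plane_rotation v1 v2 \<theta> p =
      p + (a * cos \<theta> - a - b * sin \<theta>) *\<^sub>R v1 + (a * sin \<theta> + b * cos \<theta> - b) *\<^sub>R v2"
    by (simp add: plane_rotation_def a_def b_def algebra_simps)
  moreover have "a * cos \<theta> - a - b * sin \<theta> = 2 * (a * g - b * s) * g - 2 * a"
    by (simp add: C S g_def s_def power2_eq_square algebra_simps)
  moreover have "a * sin \<theta> + b * cos \<theta> - b = 2 * (a * g - b * s) * s"
    by (simp add: C' S g_def s_def power2_eq_square algebra_simps)
  ultimately show ?thesis
    by (simp add: g_def s_def)
qed

lemma norm_cos_sin_combination:
  assumes "norm v1 = 1" "norm v2 = 1" "orthogonal v1 v2"
  shows "norm (cos \<alpha> *\<^sub>R v1 + sin \<alpha> *\<^sub>R v2) = 1"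
  using assms sin_cos_squared_add[of \<alpha>]
  by (auto simp: norm_eq_1 orthogonal_def inner_linear_simps inner_commute power2_eq_square
      algebra_simps)

lemma orthonormal_cross:
  assumes "norm v1 = 1" "norm v2 = 1" "orthogonal v1 v2"
  shows "norm (v1 \<times> v2) = 1"
  using assms norm_cross_dot[of v1 v2] norm_ge_zero[of "v1 \<times> v2"]
  by (auto simp: orthogonal_def power2_eq_1_iff simp del: norm_ge_zero)

lemma cross_cross_left:
  "(v1 \<times> v2) \<times> x = (x \<bullet> v1) *\<^sub>R v2 - (x \<bullet> v2) *\<^sub>R v1"
  using cross_skew[of "v1 \<times> v2" x] by (simp add: Lagrange)

text \<open>With \<open>n = v1 \<times> v2\<close>, the vector
  \<open>n \<times> (n \<times> x)\<close> is minus the projection of \<open>x\<close> to the plane.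
  It is computed once from \<open>v1\<close>, \<open>v2\<close> and once from \<open>n\<close>
  alone.\<close>

lemma orthonormal_expansion:
  assumes "norm v1 = 1" "norm v2 = 1" "orthogonal v1 v2"
  shows "(x \<bullet> (v1 \<times> v2)) *\<^sub>R (v1 \<times> v2) = x - (x \<bullet> v1) *\<^sub>R v1 - (x \<bullet> v2) *\<^sub>R v2"
proof -
  define n where "n = v1 \<times> v2"
  have n: "n \<bullet> n = 1"
    using orthonormal_cross[OF assms] by (simp add: n_def norm_eq_1)
  have o: "v1 \<bullet> v1 = 1" "v2 \<bullet> v2 = 1" "v1 \<bullet> v2 = 0" "v2 \<bullet> v1 = 0"
    using assms by (auto simp: norm_eq_1 orthogonal_def inner_commute)
  have "n \<times> (n \<times> x) = - ((x \<bullet> v1) *\<^sub>R v1) - (x \<bullet> v2) *\<^sub>R v2"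
    using o by (simp add: n_def cross_cross_left inner_linear_simps)
  moreover have "n \<times> (n \<times> x) = (n \<bullet> x) *\<^sub>R n - x"
    using n by (simp add: Lagrange)
  ultimately have "(n \<bullet> x) *\<^sub>R n - x = - ((x \<bullet> v1) *\<^sub>R v1) - (x \<bullet> v2) *\<^sub>R v2"
    by simp
  then show ?thesis
    by (simp add: n_def inner_commute algebra_simps)
qed

lemma axis_rotation_plane_rotation:
  assumes "norm v1 = 1" "norm v2 = 1" "orthogonal v1 v2"
  shows "axis_rotation (v1 \<times> v2) \<theta> p = plane_rotation v1 v2 \<theta> p"
proof -
  have "((1 - cos \<theta>) * ((v1 \<times> v2) \<bullet> p)) *\<^sub>R (v1 \<times> v2) =
      (1 - cos \<theta>) *\<^sub>R (p - (p \<bullet> v1) *\<^sub>R v1 - (p \<bullet> v2) *\<^sub>R v2)"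
    using orthonormal_expansion[OF assms, of p] by (metis inner_commute scaleR_scaleR)
  then show ?thesis
    by (simp add: axis_rotation_def cross_cross_left plane_rotation_def algebra_simps)
qed

lemma proper_isometry_plane_rotation:
  assumes "norm v1 = 1" "norm v2 = 1" "orthogonal v1 v2"
  shows "proper_isometry (plane_rotation v1 v2 \<theta>)"
proof -
  have "plane_rotation v1 v2 \<theta> =
      half_turn (cos (\<theta>/2) *\<^sub>R v1 + sin (\<theta>/2) *\<^sub>R v2) \<circ> half_turn v1"
    using plane_rotation_half_turns[OF assms(1,3)] by auto
  then show ?thesis
    using proper_isometry_compose proper_isometry_half_turn norm_cos_sin_combination[OF assms]
      assms(1) by metis
qed

section \<open>Existence of a rotation axis, normal form of rotations, and translations\<close>

lemma proper_isometry_axis: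
  assumes L: "proper_isometry L"
  obtains n where "norm n = 1" "L n = n"
proof -
  let ?A = "matrix L"
  have rot: "orthogonal_matrix ?A" "det ?A = 1"
    using rotation_matrix_proper_isometry[OF L] by (simp_all add: rotation_matrix_def)
  have "?A ** (mat 1 - transpose ?A) = ?A ** mat 1 - ?A ** transpose ?A"
    by (simp add: matrix_matrix_mult_def vec_eq_iff algebra_simps sum_subtractf)
  \<comment> \<open>Orthogonality factors \<open>?A\<close> out of \<open>?A - mat 1\<close>; its
    determinant 1 then relates the remaining factor to the original matrix.\<close>
  then have "?A - mat 1 = ?A ** (mat 1 - transpose ?A)"
    using rot(1) by (simp add: orthogonal_matrix_def)
  then have "det (?A - mat 1) = det (mat 1 - transpose ?A)"
    using rot(2) by (simp add: det_mul)
  also have "\<dots> = det (transpose (mat 1 - ?A))"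
    by (rule arg_cong[of _ _ det]) (simp add: transpose_def vec_eq_iff mat_def)
  \<comment> \<open>Negating a matrix of odd size 3 negates its determinant, so the determinant
    equals its own negative.\<close>
  also have "\<dots> = - det (?A - mat 1)"
    unfolding det_transpose by (simp add: det_3 algebra_simps)
  finally have "det (?A - mat 1) = 0"
    by simp
  then have "\<not> (\<forall>x. (?A - mat 1) *v x = 0 \<longrightarrow> x = 0)"
    using invertible_det_nz invertible_left_inverse matrix_left_invertible_ker by metis
  then obtain x where x: "x \<noteq> 0" "(?A - mat 1) *v x = 0"
    by blast
  then have "L x = x"
    using matrix_proper_isometry[OF L]
    by (simp add: matrix_vector_mult_diff_rdistrib)
  then have "L (x /\<^sub>R norm x) = x /\<^sub>R norm x"
    by (simp add: linear_cmul proper_isometry_linear[OF L])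
  moreover have "norm (x /\<^sub>R norm x) = 1"
    using x by simp
  ultimately show ?thesis
    using that by blast
qed

lemma unit_orthogonal_vector_exists:
  fixes x :: R3
  obtains y where "norm y = 1" "orthogonal x y"
proof -
  obtain y where y: "y \<noteq> 0" "orthogonal x y"
    using orthogonal_to_vector_exists[of x] by auto
  then show ?thesis
    by (intro that[of "y /\<^sub>R norm y"]) (simp_all add: orthogonal_def)
qed

text \<open>In a positively oriented orthonormal frame \<open>v1\<close>, \<open>v2\<close>,
  \<open>n\<close> with \<open>n\<close> on the axis, the image of \<open>v1\<close> is a point of
  the unit circle in the plane orthogonal to \<open>n\<close>; its polar angle is
  \<open>\<theta>\<close>.\<close>

lemma proper_isometry_eq_plane_rotation:
  assumes L: "proper_isometry L"
  obtains v1 v2 \<theta> where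
    "norm v1 = 1" "norm v2 = 1" "orthogonal v1 v2" "L = plane_rotation v1 v2 \<theta>"
proof -
  obtain n where n: "norm n = 1" "L n = n"
    using proper_isometry_axis[OF L] .
  obtain v1 where v1: "norm v1 = 1" "orthogonal n v1"
    using unit_orthogonal_vector_exists .
  define v2 where "v2 = n \<times> v1"
  have v2: "norm v2 = 1"
    unfolding v2_def by (rule orthonormal_cross[OF n(1) v1])
  have o: "orthogonal v1 v2"
    by (simp add: v2_def orthogonal_def dot_cross_self)
  have i: "n \<bullet> n = 1" "v1 \<bullet> v1 = 1" "n \<bullet> v1 = 0" "v1 \<bullet> n = 0"
    using n v1 by (auto simp: norm_eq_1 orthogonal_def inner_commute)
  have v12: "v1 \<times> v2 = n"
    using i by (simp add: v2_def Lagrange)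
  have nv2: "n \<times> v2 = - v1"
    using i by (simp add: v2_def Lagrange)
  have expand: "x = (x \<bullet> v1) *\<^sub>R v1 + (x \<bullet> v2) *\<^sub>R v2 + (x \<bullet> n) *\<^sub>R n" for x
    using orthonormal_expansion[OF v1(1) v2 o, of x] by (simp add: v12)
  define a b where "a = L v1 \<bullet> v1" and "b = L v1 \<bullet> v2"
  have "L v1 \<bullet> n = 0"
    using proper_isometry_inner[OF L, of v1 n] n(2) i by simp
  then have Lv1: "L v1 = a *\<^sub>R v1 + b *\<^sub>R v2"
    using expand[of "L v1"] by (simp add: a_def b_def)
  \<comment> \<open>Since \<open>v2 = n \<times> v1\<close> and \<open>L\<close> fixes
    \<open>n\<close>, the image of \<open>v2\<close> is \<open>n \<times> L v1\<close>.\<close>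
  have Lv2: "L v2 = a *\<^sub>R v2 - b *\<^sub>R v1"
    using proper_isometry_cross[OF L, of n v1] nv2
    by (simp add: n(2) Lv1 cross_linear_simps v2_def[symmetric])
  have "L v1 \<bullet> L v1 = 1"
    using proper_isometry_inner[OF L] i by simp
  then have "a\<^sup>2 + b\<^sup>2 = 1"
    using i v2 o
    by (simp add: Lv1 inner_linear_simps orthogonal_def norm_eq_1 inner_commute power2_eq_square)
  then obtain \<theta> where \<theta>: "a = cos \<theta>" "b = sin \<theta>"
    using sincos_total_2pi by blast
  have "L p = plane_rotation v1 v2 \<theta> p" for p
  proof -
    have "L p = L ((p \<bullet> v1) *\<^sub>R v1 + (p \<bullet> v2) *\<^sub>R v2 + (p \<bullet> n) *\<^sub>R n)"
      using expand[of p] by simp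
    also have "\<dots> = (p \<bullet> v1) *\<^sub>R L v1 + (p \<bullet> v2) *\<^sub>R L v2 + (p \<bullet> n) *\<^sub>R n"
      by (simp add: linear_add linear_cmul proper_isometry_linear[OF L] n(2))
    also have "(p \<bullet> n) *\<^sub>R n = p - (p \<bullet> v1) *\<^sub>R v1 - (p \<bullet> v2) *\<^sub>R v2"
      using expand[of p] by (simp add: algebra_simps)
    finally show ?thesis
      by (simp add: plane_rotation_def Lv1 Lv2 \<theta> algebra_simps)
  qed
  then show ?thesis
    using that v1(1) v2 o by blast
qed

text \<open>Half-turns about parallel lines compose to the translation by twice their displacement.
  The direction \<open>w\<close> is taken orthogonal to \<open>t\<close>, and the lines pass through
  the origin and \<open>t/2\<close>.\<close>

lemma induces_translation:
  obtains w where "norm w = 1"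
    "induces (reflection (w, - w + ((1/2) *\<^sub>R t) \<times> w) \<circ> reflection (w, w + ((1/2) *\<^sub>R t) \<times> w) \<circ>
       reflection (w, - w + 0 \<times> w) \<circ> reflection (w, w + 0 \<times> w)) (\<lambda>p. p + t)"
proof -
  obtain w where w: "norm w = 1" "orthogonal t w"
    using unit_orthogonal_vector_exists .
  then have "w \<bullet> w = 1" "t \<bullet> w = 0"
    by (auto simp: norm_eq_1 orthogonal_def)
  then have "p + t = half_turn w (half_turn w p) +
      ((1/2) *\<^sub>R t - half_turn w ((1/2) *\<^sub>R t) + half_turn w (0 - half_turn w 0))" for p
    by (simp add: half_turn_def inner_linear_simps flip: scaleR_2)
  then show ?thesis
    by (rule that[OF w(1) induces_two_half_turns[OF w(1) w(1)]])
qed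

section \<open>The explicit motion: its center, its screw axis and the four reflections\<close>

context
  fixes v1 v2 t n c w :: R3 and \<theta> d :: real
  assumes orthonormal: "norm v1 = 1" "norm v2 = 1" "orthogonal v1 v2"
    and angle: "\<And>k :: int. \<theta> \<noteq> 2 * pi * of_int k"
  defines "n \<equiv> v1 \<times> v2"
    and "d \<equiv> t \<bullet> n"
    and "c \<equiv> (1 / (2 * sin (\<theta> / 2))) *\<^sub>R
      axis_rotation n ((pi - \<theta>) / 2) (t - (t \<bullet> n) *\<^sub>R n)"
    and "w \<equiv> cos (\<theta> / 2) *\<^sub>R v1 + sin (\<theta> / 2) *\<^sub>R v2"
begin

text \<open>Excluding all full turns makes the division in the definition of \<open>c\<close>
  meaningful.\<close>

lemma sin_half_angle: "sin (\<theta> / 2) \<noteq> 0"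
proof
  assume "sin (\<theta> / 2) = 0"
  then obtain k :: int where "\<theta> / 2 = of_int k * pi"
    using sin_zero_iff_int2 by blast
  then show False
    using angle[of k] by simp
qed

lemma normal_inner: "n \<bullet> n = 1" "n \<bullet> v1 = 0" "n \<bullet> w = 0"
  using orthonormal_cross[OF orthonormal]
  by (simp_all add: n_def w_def norm_eq_1 inner_linear_simps inner_commute dot_cross_self)

lemma norm_w: "norm w = 1"
  unfolding w_def by (rule norm_cos_sin_combination[OF orthonormal])

lemma rotation_half_turns: "plane_rotation v1 v2 \<theta> p = half_turn w (half_turn v1 p)"
  unfolding w_def by (rule plane_rotation_half_turns[OF orthonormal(1,3)])

lemma center_orthogonal: "c \<bullet> n = 0" "n \<bullet> c = 0"
  using normal_inner(1)
  by (simp_all add: c_def axis_rotation_def inner_linear_simps dot_cross_self inner_commute)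

text \<open>This says that \<open>c\<close> is fixed by the rotation followed by the part of the
  translation orthogonal to \<open>n\<close>.\<close>

lemma center_equation: "c - plane_rotation v1 v2 \<theta> c = t - d *\<^sub>R n"
proof -
  define s where "s = t - d *\<^sub>R n"
  define k where "k = 1 / (2 * sin (\<theta> / 2))"
  define \<alpha> where "\<alpha> = (pi - \<theta>) / 2"
  have ns: "n \<bullet> s = 0"
    using normal_inner(1) by (simp add: s_def d_def inner_linear_simps inner_commute)
  have nns: "n \<times> (n \<times> s) = - s"
    using normal_inner(1) ns by (simp add: Lagrange)
  \<comment> \<open>On the plane of \<open>s\<close> and \<open>n \<times> s\<close>, rotating adds
    angles, so the image of \<open>c\<close> has the same form with
    \<open>\<alpha> + \<theta>\<close> in place of \<open>\<alpha>\<close>.\<close>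
  have c: "c = k *\<^sub>R (cos \<alpha> *\<^sub>R s + sin \<alpha> *\<^sub>R (n \<times> s))"
    using ns by (simp add: c_def k_def s_def \<alpha>_def d_def axis_rotation_def)
  have "plane_rotation v1 v2 \<theta> c = cos \<theta> *\<^sub>R c + sin \<theta> *\<^sub>R (n \<times> c)"
    using axis_rotation_plane_rotation[OF orthonormal, of \<theta> c] center_orthogonal
    by (simp add: axis_rotation_def n_def)
  also have "\<dots> = k *\<^sub>R (cos (\<alpha> + \<theta>) *\<^sub>R s + sin (\<alpha> + \<theta>) *\<^sub>R (n \<times> s))"
    by (simp add: c cross_linear_simps nns cos_add sin_add algebra_simps)
  finally have "c - plane_rotation v1 v2 \<theta> c =
      k *\<^sub>R ((cos \<alpha> - cos (\<alpha> + \<theta>)) *\<^sub>R s + (sin \<alpha> - sin (\<alpha> + \<theta>)) *\<^sub>R (n \<times> s))"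
    by (simp add: c algebra_simps)
  \<comment> \<open>The angles \<open>\<alpha>\<close> and \<open>\<alpha> + \<theta>\<close> lie
    symmetrically about a right angle: their sines agree, their cosines are opposite. What remains
    is \<open>2 * sin (\<theta> / 2)\<close> times \<open>s\<close>, which \<open>k\<close>
    normalizes.\<close>
  moreover have "\<alpha> = pi / 2 - \<theta> / 2"
    by (simp add: \<alpha>_def field_simps)
  then have "cos \<alpha> = sin (\<theta> / 2)" "sin \<alpha> = cos (\<theta> / 2)"
    by (simp_all add: cos_diff sin_diff)
  moreover have "\<alpha> + \<theta> = pi / 2 + \<theta> / 2"
    by (simp add: \<alpha>_def field_simps)
  then have "cos (\<alpha> + \<theta>) = - sin (\<theta> / 2)" "sin (\<alpha> + \<theta>) = cos (\<theta> / 2)"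
    by (simp_all add: cos_add sin_add)
  ultimately show ?thesis
    using sin_half_angle by (simp add: k_def s_def flip: mult_2)
qed

text \<open>Moving the center of rotation from the origin to \<open>c\<close> adds \<open>c\<close>
  minus its rotated image, which the center equation evaluates.\<close>

lemma motion_screw: "(\<lambda>p. plane_rotation v1 v2 \<theta> p + t) = screw_motion c n \<theta> d"
proof
  fix p
  have "plane_rotation v1 v2 \<theta> (p - c) = plane_rotation v1 v2 \<theta> p - plane_rotation v1 v2 \<theta> c"
    using proper_isometry_linear[OF proper_isometry_plane_rotation[OF orthonormal]]
    by (rule linear_diff)
  then have "screw_motion c n \<theta> d p =
      plane_rotation v1 v2 \<theta> p + (c - plane_rotation v1 v2 \<theta> c) + d *\<^sub>R n"
    unfolding screw_motion_def n_def axis_rotation_plane_rotation[OF orthonormal] by simp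
  then show "plane_rotation v1 v2 \<theta> p + t = screw_motion c n \<theta> d p"
    unfolding center_equation by simp
qed

lemma center_foot: "foot_of_perpendicular 0 (line_along c n) c"
proof -
  have "c \<in> line_along c n"
    unfolding line_along_def by (rule image_eqI[of _ _ 0]) simp_all
  then show ?thesis
    using center_orthogonal
    by (auto simp: foot_of_perpendicular_def line_along_def orthogonal_def)
qed

text \<open>Half-turns reverse vectors along the common normal \<open>n\<close>. Hence moving the
  second axis by half of \<open>d\<close> along \<open>n\<close>, or the first one backwards by the
  same amount, adds the full translation by \<open>d\<close> along \<open>n\<close>.\<close>

lemma induces_motion:
  assumes "q = c + (d / 2) *\<^sub>R n \<and> r = c \<or> q = c \<and> r = c - (d / 2) *\<^sub>R n"
  shows "induces (reflection (w, - w + q \<times> w) \<circ> reflection (w, w + q \<times> w) \<circ>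
    reflection (v1, - v1 + r \<times> v1) \<circ> reflection (v1, v1 + r \<times> v1))
      (\<lambda>p. plane_rotation v1 v2 \<theta> p + t)"
proof (rule induces_two_half_turns[OF norm_w orthonormal(1)])
  fix p
  have lin: "linear (half_turn w)" "linear (half_turn v1)"
    using norm_w orthonormal(1) by (simp_all add: proper_isometry_half_turn proper_isometry_linear)
  define e where "e = (d / 2) *\<^sub>R n"
  have e: "d *\<^sub>R n = e + e" "half_turn w e = - e" "half_turn v1 e = - e"
    using normal_inner by (simp_all add: e_def half_turn_def flip: scaleR_add_left)
  \<comment> \<open>Here \<open>2 * e\<close> is the componentwise product of vectors, that is,
    \<open>e + e\<close>.\<close>
  have e2: "half_turn w (2 * e) = - (2 * e)"
    using e(2) linear_add[OF lin(1), of e e] by (simp flip: mult_2)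
  have "t = c - half_turn w (half_turn v1 c) + d *\<^sub>R n"
    using center_equation by (simp add: rotation_half_turns algebra_simps)
  also have "\<dots> = q - half_turn w q + half_turn w (r - half_turn v1 r)"
    using assms unfolding e_def[symmetric] e(1)
    by (elim disjE conjE)
       (simp_all add: e e2 linear_add[OF lin(1)] linear_diff[OF lin(1)] linear_neg[OF lin(1)]
          linear_diff[OF lin(2)])
  finally show "plane_rotation v1 v2 \<theta> p + t = half_turn w (half_turn v1 p) +
      (q - half_turn w q + half_turn w (r - half_turn v1 r))"
    by (simp add: rotation_half_turns)
qed

end

section \<open>Reduction of an arbitrary rigid-body motion to the explicit cases\<close>

lemma rigid_body_motion_four_reflections:
  assumes "rigid_body_motion f"
  obtains w v q r where "norm w = 1" "norm v = 1"
    "induces (reflection (w, - w + q \<times> w) \<circ> reflection (w, w + q \<times> w) \<circ>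
      reflection (v, - v + r \<times> v) \<circ> reflection (v, v + r \<times> v)) f"
proof -
  obtain R t where R: "rotation_matrix R" and f: "f = (\<lambda>p. R *v p + t)"
    using assms unfolding rigid_body_motion_def by blast
  obtain v1 v2 \<theta> where v: "norm v1 = 1" "norm v2 = 1" "orthogonal v1 v2"
    and rot: "(\<lambda>x. R *v x) = plane_rotation v1 v2 \<theta>"
    using proper_isometry_eq_plane_rotation[OF proper_isometry_rotation_matrix[OF R]] .
  have f': "f = (\<lambda>p. plane_rotation v1 v2 \<theta> p + t)"
    using f fun_cong[OF rot] by auto
  show ?thesis
  \<comment> \<open>The angle found for \<open>R\<close> may be a full turn; then \<open>R\<close>
    is the identity and the motion is a pure translation.\<close>
  proof (cases "\<exists>k :: int. \<theta> = 2 * pi * of_int k")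
    case True
    then have "cos \<theta> = 1" "sin \<theta> = 0"
      by (auto simp: cos_int_2pin sin_int_2pin)
    then have "f = (\<lambda>p. p + t)"
      unfolding f' plane_rotation_def by simp
    then show ?thesis
      using induces_translation[of t] that by metis
  next
    case False
    then have angle: "\<And>k :: int. \<theta> \<noteq> 2 * pi * of_int k"
      by blast
    show ?thesis
      \<comment> \<open>\<open>disjI2\<close> selects the second choice: the first axis, with
        direction \<open>v1\<close>, carries the displacement.\<close>
      by (rule that[OF norm_w[OF v angle] v(1)
            induces_motion[OF v angle disjI2[OF conjI[OF refl refl]], of t, folded f']])
  qed
qed

theorem proposition28:
  shows
    "(\<forall>f. rigid_body_motion f \<longrightarrow>
       (\<exists>U1 U2 U3 U4.
          invertible_R33 U1 \<and> invertible_R33 U2 \<and> invertible_R33 U3 \<and> invertible_R33 U4 \<and>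
          (\<exists>h. induces (reflection U1 \<circ> reflection U2) h) \<and>
          (\<exists>h. induces (reflection U3 \<circ> reflection U4) h) \<and>
          induces (reflection U1 \<circ> reflection U2 \<circ> reflection U3 \<circ> reflection U4) f))
     \<and>
     (\<forall>(v1 :: R3) (v2 :: R3) (\<theta> :: real) (t :: R3).
        norm v1 = 1 \<longrightarrow> norm v2 = 1 \<longrightarrow> orthogonal v1 v2 \<longrightarrow>
        (\<forall>k :: int. \<theta> \<noteq> 2 * pi * of_int k) \<longrightarrow>
        (let R = plane_rotation v1 v2 \<theta>;
             n = v1 \<times> v2;
             \<gamma> = cos (\<theta> / 2);
             \<sigma> = sin (\<theta> / 2);
             d = t \<bullet> n;
             c = (1 / (2 * sin (\<theta> / 2))) *\<^sub>R
                   axis_rotation n ((pi - \<theta>) / 2) (t - (t \<bullet> n) *\<^sub>R n);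
             w = \<gamma> *\<^sub>R v1 + \<sigma> *\<^sub>R v2
         in rigid_body_motion (\<lambda>p. R p + t) \<and>
            (\<lambda>p. R p + t) = screw_motion c n \<theta> d \<and>
            foot_of_perpendicular 0 (line_along c n) c \<and>
            (\<forall>m1 m2.
               (m1 = (c + (d / 2) *\<^sub>R n) \<times> w \<and> m2 = c \<times> v1) \<or>
               (m1 = c \<times> w \<and> m2 = (c - (d / 2) *\<^sub>R n) \<times> v1) \<longrightarrow>
               (let U1 = (w, - w + m1);
                    U2 = (w, w + m1);
                    U3 = (v1, - v1 + m2);
                    U4 = (v1, v1 + m2)
                in invertible_R33 U1 \<and> invertible_R33 U2 \<and>
                   invertible_R33 U3 \<and> invertible_R33 U4 \<and>
                   (\<exists>h. induces (reflection U1 \<circ> reflection U2) h) \<and>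
                   (\<exists>h. induces (reflection U3 \<circ> reflection U4) h) \<and>
                   induces (reflection U1 \<circ> reflection U2 \<circ> reflection U3 \<circ> reflection U4)
                     (\<lambda>p. R p + t)))))"
proof (intro conjI allI impI, goal_cases)
  case (1 f)
  obtain w v q r where u: "norm w = 1" "norm v = 1"
    and ind: "induces (reflection (w, - w + q \<times> w) \<circ> reflection (w, w + q \<times> w) \<circ>
      reflection (v, - v + r \<times> v) \<circ> reflection (v, v + r \<times> v)) f"
    using rigid_body_motion_four_reflections[OF 1] .
  show ?case
    using ind invertible_line_pair[OF u(1), of q] invertible_line_pair[OF u(2), of r]
      induces_half_turn[OF u(1), of q] induces_half_turn[OF u(2), of r]
    by blast
next
  case (2 v1 v2 \<theta> t)
  then have v: "norm v1 = 1" "norm v2 = 1" "orthogonal v1 v2"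
    and angle: "\<And>k :: int. \<theta> \<noteq> 2 * pi * of_int k"
    by blast+
  note w = norm_w[OF v angle]
  show ?case
    unfolding Let_def
  proof (intro conjI, goal_cases)
    case 1
    show ?case
      by (rule rigid_body_motion_proper_isometry[OF proper_isometry_plane_rotation[OF v]])
  next
    case 2
    show ?case
      by (rule motion_screw[OF v angle])
  next
    case 3
    show ?case
      by (rule center_foot[OF v angle])
  next
    case 4
    show ?case
    proof (intro allI impI, goal_cases)
      case (1 m1 m2)
      \<comment> \<open>Each choice of \<open>m1\<close> and \<open>m2\<close> is a pair of moments
        of lines through suitable points \<open>q\<close> and \<open>r\<close>; this is the form
        that the results on half-turns accept.\<close>
      then obtain q r where m: "m1 = q \<times> (cos (\<theta> / 2) *\<^sub>R v1 + sin (\<theta> / 2) *\<^sub>R v2)" "m2 = r \<times> v1"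
        and ind: "induces (reflection (cos (\<theta> / 2) *\<^sub>R v1 + sin (\<theta> / 2) *\<^sub>R v2,
            - (cos (\<theta> / 2) *\<^sub>R v1 + sin (\<theta> / 2) *\<^sub>R v2) + m1) \<circ>
          reflection (cos (\<theta> / 2) *\<^sub>R v1 + sin (\<theta> / 2) *\<^sub>R v2,
            cos (\<theta> / 2) *\<^sub>R v1 + sin (\<theta> / 2) *\<^sub>R v2 + m1) \<circ>
          reflection (v1, - v1 + m2) \<circ> reflection (v1, v1 + m2)) (\<lambda>p. plane_rotation v1 v2 \<theta> p + t)"
        using induces_motion[OF v angle, of _ t] by blast
      show ?case
        using ind invertible_line_pair[OF w, of q] invertible_line_pair[OF v(1), of r]
          induces_half_turn[OF w, of q] induces_half_turn[OF v(1), of r]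
        unfolding m by blast
    qed
  qed
qed

end
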